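(* Suppose $X$ is a countably compact space which is the union of finitely many subspaces each of which is a $D$-space. Then $X$ is compact.
   Context: A space is countably compact if every countable open cover has a finite subcover. A neighborhood assignment on a space $Y$ is a family $\{N(y):y\in Y\}$ of subsets of $Y$ with $y\in \operatorname{Int} N(y)$ for each $y\in Y$. A space $Y$ is a $D$-space if for every neighborhood assignment $\{N(y):y\in Y\}$ on $Y$ there is a closed discrete subset $D$ of $Y$ such that $Y=\bigcup\{N(y):y\in D\}$. *)

theory Defs
  imports "HOL-Analysis.Analysis"
begin

text \<open>
  Topological spaces are elements of \<^typ>\<open>'a topology\<close>; no separation axioms are assumed.
\<close>

text \<open>
  The library's \<open>countably_compact\<close> concerns subsets of a type in class \<open>topological_space\<close>;
  this is the same notion for an abstract topology, parallel to \<^const>\<open>compact_space\<close>.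
\<close>

definition countably_compact_space :: "'a topology \<Rightarrow> bool" where
  "countably_compact_space X \<longleftrightarrow>
     (\<forall>\<U>. countable \<U> \<and> (\<forall>U\<in>\<U>. openin X U) \<and> topspace X \<subseteq> \<Union>\<U>
        \<longrightarrow> (\<exists>\<F>. finite \<F> \<and> \<F> \<subseteq> \<U> \<and> topspace X \<subseteq> \<Union>\<F>))"

text \<open>Values of \<open>N\<close> outside \<open>topspace Y\<close> are irrelevant.\<close>

definition neighborhood_assignment :: "'a topology \<Rightarrow> ('a \<Rightarrow> 'a set) \<Rightarrow> bool" where
  "neighborhood_assignment Y N \<longleftrightarrow>
     (\<forall>y\<in>topspace Y. N y \<subseteq> topspace Y \<and> y \<in> Y interior_of (N y))"

definition closed_discrete_in :: "'a topology \<Rightarrow> 'a set \<Rightarrow> bool" where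
  "closed_discrete_in Y D \<longleftrightarrow> closedin Y D \<and> subtopology Y D = discrete_topology D"

definition D_space :: "'a topology \<Rightarrow> bool" where
  "D_space Y \<longleftrightarrow>
     (\<forall>N. neighborhood_assignment Y N \<longrightarrow>
        (\<exists>D. closed_discrete_in Y D \<and> topspace Y = (\<Union>y\<in>D. N y)))"

end

theory Submission
  imports Defs
begin

text \<open>
  The proof is a double induction: on the number of pieces, and along a well-ordering of the
  open cover. It is carried out for every closed \<open>C \<subseteq> \<Union>\<Y>\<close>, since both inductions pass to smaller
  closed sets.

  Let \<open>\<J>\<close> be an open cover of \<open>C\<close>, well-ordered by \<open>r\<close>. For \<open>Y \<in> \<Y>\<close>, assign to each point of
  \<open>C \<inter> Y\<close> the least member of \<open>\<J>\<close> containing it, and let \<open>D\<close> be a closed discrete subset of \<open>Y\<close>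
  for this assignment. By countable compactness all but finitely many points of \<open>D\<close> lie in any
  given open set around the cluster set of \<open>D\<close> (\<open>closed_discrete_clusters_outside\<close>). That cluster
  set is closed and, as \<open>D\<close> is closed in \<open>Y\<close>, it is disjoint from \<open>Y\<close>; so it is covered by the
  remaining pieces and is compact by induction. Hence finitely many members of \<open>\<J>\<close> cover \<open>D\<close>.
  This does not say that finitely many of the sets assigned to points of \<open>D\<close> suffice, but it
  bounds their positions in the well-ordering: the set assigned to \<open>d\<close> precedes every member
  containing \<open>d\<close>. So \<open>C \<inter> Y\<close>, and after taking a maximum over \<open>\<Y>\<close> the whole of \<open>C\<close>, is covered
  by the members up to some \<open>\<delta> \<in> \<J>\<close> (\<open>closed_subset_initial_segment\<close>).

  The closed set \<open>C - \<delta>\<close> is then covered by the members strictly before \<open>\<delta>\<close>, so the same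
  argument gives a cover of it by the members up to some \<open>\<delta>' < \<delta>\<close>. Well-foundedness stops
  this descent after finitely many steps, and the \<open>\<delta>\<close>s met on the way form a finite subcover.
\<close>

lemma linear_order_cases:
  assumes "linear_order r"
  shows "(x, y) \<in> r \<or> (y, x) \<in> r"
proof (cases "x = y")
  case True
  then show ?thesis
    using assms by (simp add: linear_order_on_def partial_order_on_def preorder_on_def refl_on_def)
next
  case False
  then show ?thesis
    using assms by (simp add: linear_order_on_def total_on_def)
qed

lemma linear_order_trans:
  assumes "linear_order r"
  shows "trans r"
  using assms by (simp add: linear_order_on_def partial_order_on_def preorder_on_def)

lemma well_order_least:
  assumes "well_order r" "S \<noteq> {}"
  shows "\<exists>m\<in>S. \<forall>s\<in>S. (m, s) \<in> r"
proof -
  have wf: "wf (r - Id)" and lin: "linear_order r"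
    using assms(1) by (simp_all add: well_order_on_def)
  obtain m where m: "m \<in> S" "\<And>y. (y, m) \<in> r - Id \<Longrightarrow> y \<notin> S"
    using wfE_min'[OF wf assms(2)] by metis
  have "(m, s) \<in> r" if "s \<in> S" for s
    using linear_order_cases[OF lin, of m s] m(2)[of s] that by auto
  then show ?thesis using m(1) by blast
qed

lemma linear_order_finite_greatest:
  assumes lin: "linear_order r" and "finite S" "S \<noteq> {}"
  shows "\<exists>m\<in>S. \<forall>s\<in>S. (s, m) \<in> r"
  using assms(2,3)
proof (induction rule: finite_ne_induct)
  case (singleton x)
  then show ?case
    using linear_order_cases[OF lin, of x x] by blast
next
  case (insert x F)
  then obtain m where m: "m \<in> F" "\<And>s. s \<in> F \<Longrightarrow> (s, m) \<in> r" by blast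
  have "(x, m) \<in> r \<or> (m, x) \<in> r"
    using linear_order_cases[OF lin] .
  then show ?case
  proof
    assume "(x, m) \<in> r"
    then show ?thesis using m by blast
  next
    assume "(m, x) \<in> r"
    then have "(s, x) \<in> r" if "s \<in> F" for s
      using m(2)[OF that] transD[OF linear_order_trans[OF lin]] by blast
    moreover have "(x, x) \<in> r" using linear_order_cases[OF lin, of x x] by blast
    ultimately have "\<forall>s\<in>insert x F. (s, x) \<in> r" by simp
    then show ?thesis by blast
  qed
qed

text \<open>
  Closed subspaces inherit the D-property: an assignment on \<open>K\<close> extends to the whole space by
  giving every other point the complement of \<open>K\<close>, and those sets contribute nothing to
  covering \<open>K\<close>.
\<close>

lemma D_space_closed_kernel:
  assumes "D_space Z" and K: "closedin Z K"
    and N: "\<And>y. y \<in> K \<Longrightarrow> openin Z (N y) \<and> y \<in> N y"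
  shows "\<exists>D\<subseteq>K. closed_discrete_in Z D \<and> K \<subseteq> (\<Union>y\<in>D. N y)"
proof -
  define M where "M y = (if y \<in> K then N y else topspace Z - K)" for y
  have op: "openin Z (M y) \<and> y \<in> M y" if "y \<in> topspace Z" for y
    using that N K by (auto simp: M_def)
  then have "neighborhood_assignment Z M"
    unfolding neighborhood_assignment_def
    by (metis interior_of_openin openin_subset)
  then obtain D where D: "closed_discrete_in Z D" "topspace Z = (\<Union>y\<in>D. M y)"
    using assms(1) unfolding D_space_def by blast
  have "subtopology Z (D \<inter> K) = discrete_topology (D \<inter> K)"
    using D(1) unfolding closed_discrete_in_def
    by (metis subtopology_subtopology subtopology_discrete_topology)
  then have "closed_discrete_in Z (D \<inter> K)"
    using D(1) K by (simp add: closed_discrete_in_def closedin_Int)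
  moreover have "K \<subseteq> (\<Union>y\<in>D \<inter> K. N y)"
  proof
    fix x assume x: "x \<in> K"
    then have "x \<in> topspace Z" using K closedin_subset by blast
    then obtain d where "d \<in> D" "x \<in> M d" using D(2) by blast
    then show "x \<in> (\<Union>y\<in>D \<inter> K. N y)" using x by (auto simp: M_def split: if_splits)
  qed
  ultimately show ?thesis by blast
qed

text \<open>
  The set \<open>F\<close> is what is left of the closure of \<open>D\<close> after removing open sets that isolate the
  points of \<open>D\<close>; without separation axioms these sets may meet the closure of \<open>D\<close> in more than
  \<open>D\<close>. If infinitely many points of \<open>D\<close> avoided an open \<open>V \<supseteq> F\<close>, a countably infinite set of
  them would have its closure covered by its own isolating sets, and countable compactness would
  leave only finitely many of these.
\<close>

lemma closed_discrete_clusters_outside: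
  assumes cc: "countably_compact_space X"
    and D: "closed_discrete_in (subtopology X Y) D"
  shows "\<exists>F. closedin X F \<and> F \<subseteq> X closure_of D \<and> F \<inter> Y = {} \<and>
             (\<forall>V. openin X V \<and> F \<subseteq> V \<longrightarrow> finite (D - V))"
proof -
  have clD: "closedin (subtopology X Y) D"
    and disc: "subtopology (subtopology X Y) D = discrete_topology D"
    using D by (auto simp: closed_discrete_in_def)
  have DY: "D \<subseteq> Y" and DX: "D \<subseteq> topspace X"
    using closedin_subset[OF clD] by auto
  have "\<exists>W. openin X W \<and> W \<inter> D = {d}" if "d \<in> D" for d
  proof -
    have "openin (subtopology X D) {d}"
      using disc that DY by (metis Int_absorb1 openin_discrete_topology subtopology_subtopology
          empty_subsetI insert_subset)
    then show ?thesis unfolding openin_subtopology by (metis)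
  qed
  then obtain W where W: "\<And>d. d \<in> D \<Longrightarrow> openin X (W d) \<and> W d \<inter> D = {d}" by metis
  define F where "F = X closure_of D - (\<Union>d\<in>D. W d)"
  have "closedin X F" unfolding F_def using W by (intro closedin_diff) auto
  moreover have "F \<subseteq> X closure_of D" by (auto simp: F_def)
  moreover have "F \<inter> Y = {}"
  proof -
    obtain T where "closedin X T" "D = T \<inter> Y"
      using clD by (auto simp: closedin_subtopology)
    then have "X closure_of D \<inter> Y \<subseteq> D"
      using closure_of_minimal[of D T X] by blast
    then show ?thesis using W by (force simp: F_def)
  qed
  moreover have "finite (D - V)" if V: "openin X V" "F \<subseteq> V" for V
  proof (rule ccontr)
    assume "infinite (D - V)"
    then obtain E where E: "countable E" "infinite E" "E \<subseteq> D - V"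
      using infinite_countable_subset' by blast
    have "closedin X (topspace X - V)" using V(1) by blast
    then have "X closure_of E \<subseteq> topspace X - V"
      using E(3) DX by (intro closure_of_minimal) auto
    moreover have "X closure_of E \<subseteq> X closure_of D"
      using E(3) by (intro closure_of_mono) auto
    ultimately have sub: "X closure_of E \<subseteq> (\<Union>d\<in>D. W d)"
      using V(2) by (auto simp: F_def)
    \<comment> \<open>An isolating set that meets the closure of \<open>E\<close> meets \<open>E\<close> itself, hence isolates a
        point of \<open>E\<close>. This makes the cover countable.\<close>
    have "X closure_of E \<subseteq> (\<Union>d\<in>E. W d)"
    proof
      fix x assume x: "x \<in> X closure_of E"
      then obtain d where d: "d \<in> D" "x \<in> W d" using sub by blast
      then obtain e where "e \<in> E" "e \<in> W d" using x W by (meson in_closure_of)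
      then have "e = d" using W[OF d(1)] E(3) by blast
      then show "x \<in> (\<Union>d\<in>E. W d)" using \<open>e \<in> E\<close> d by blast
    qed
    then have "topspace X \<subseteq> \<Union>(insert (topspace X - X closure_of E) (W ` E))" by blast
    moreover have "\<forall>U\<in>insert (topspace X - X closure_of E) (W ` E). openin X U"
      using W E(3) by (auto intro: openin_diff)
    moreover have "countable (insert (topspace X - X closure_of E) (W ` E))"
      using E(1) by simp
    ultimately obtain \<F> where \<F>: "finite \<F>"
      "\<F> \<subseteq> insert (topspace X - X closure_of E) (W ` E)" "topspace X \<subseteq> \<Union>\<F>"
      using cc unfolding countably_compact_space_def by meson
    have EX: "E \<subseteq> topspace X" using E(3) DX by blast
    have "E \<subseteq> X closure_of E" using closure_of_subset[OF EX] .
    have "finite (A \<inter> E)" if "A \<in> \<F>" for A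
    proof (cases "A \<in> W ` E")
      case True
      then obtain d where "d \<in> E" "A = W d" by blast
      then have "A \<inter> E \<subseteq> {d}" using W E(3) by blast
      then show ?thesis using finite_subset by blast
    next
      case False
      then have "A \<inter> E = {}" using that \<F>(2) \<open>E \<subseteq> X closure_of E\<close> by blast
      then show ?thesis by simp
    qed
    then have "finite (\<Union>A\<in>\<F>. A \<inter> E)" using \<F>(1) by blast
    moreover have "E \<subseteq> (\<Union>A\<in>\<F>. A \<inter> E)" using \<F>(3) EX by blast
    ultimately show False using E(2) finite_subset by blast
  qed
  ultimately show ?thesis by blast
qed

text \<open>
  Finitely many members cover the compact cluster set of the kernel \<open>D\<close>, and the finitely many points
  of \<open>D\<close> outside them contribute one member each; together these form \<open>\<G>\<close>. The assignment picks
  least members, so covering a point \<open>d \<in> D\<close> by a member \<open>G\<close> already bounds the set assigned to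
  \<open>d\<close> by \<open>G\<close>.
\<close>

lemma D_piece_initial_segment:
  assumes cc: "countably_compact_space X" and wo: "well_order r"
    and DY: "D_space (subtopology X Y)" and YX: "Y \<subseteq> topspace X"
    and C: "closedin X C"
    and op: "\<And>U. U \<in> \<J> \<Longrightarrow> openin X U" and cov: "C \<subseteq> \<Union>\<J>"
    and comp: "\<And>F. closedin X F \<Longrightarrow> F \<subseteq> C \<Longrightarrow> F \<inter> Y = {} \<Longrightarrow> compactin X F"
  shows "\<exists>\<G>. finite \<G> \<and> \<G> \<subseteq> \<J> \<and> C \<inter> Y \<subseteq> \<Union>{U \<in> \<J>. \<exists>G\<in>\<G>. (U, G) \<in> r}"
proof -
  have refl: "(U, U) \<in> r" for U
    using wo linear_order_cases[of r U U] by (simp add: well_order_on_def)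
  have "\<exists>U. U \<in> \<J> \<and> y \<in> U \<and> (\<forall>U'\<in>\<J>. y \<in> U' \<longrightarrow> (U, U') \<in> r)" if "y \<in> C" for y
  proof -
    have "{U \<in> \<J>. y \<in> U} \<noteq> {}" using cov that by blast
    from well_order_least[OF wo this] show ?thesis by blast
  qed
  then obtain \<alpha> where \<alpha>: "\<And>y. y \<in> C \<Longrightarrow> \<alpha> y \<in> \<J> \<and> y \<in> \<alpha> y"
    and least: "\<And>y U. y \<in> C \<Longrightarrow> U \<in> \<J> \<Longrightarrow> y \<in> U \<Longrightarrow> (\<alpha> y, U) \<in> r"
    by metis
  have "closedin (subtopology X Y) (C \<inter> Y)"
    using C closedin_subtopology by blast
  moreover have "openin (subtopology X Y) (\<alpha> y \<inter> Y) \<and> y \<in> \<alpha> y \<inter> Y" if "y \<in> C \<inter> Y" for y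
    using that \<alpha> op openin_subtopology by blast
  ultimately obtain D where D: "D \<subseteq> C \<inter> Y" "closed_discrete_in (subtopology X Y) D"
      "C \<inter> Y \<subseteq> (\<Union>y\<in>D. \<alpha> y \<inter> Y)"
    using D_space_closed_kernel[OF DY, of "C \<inter> Y" "\<lambda>y. \<alpha> y \<inter> Y"] by blast
  from closed_discrete_clusters_outside[OF cc D(2)]
  obtain F where "closedin X F \<and> F \<subseteq> X closure_of D \<and> F \<inter> Y = {} \<and>
      (\<forall>V. openin X V \<and> F \<subseteq> V \<longrightarrow> finite (D - V))" ..
  then have F: "closedin X F" "F \<subseteq> X closure_of D" "F \<inter> Y = {}"
      "\<And>V. openin X V \<Longrightarrow> F \<subseteq> V \<Longrightarrow> finite (D - V)"
    by simp_all
  have "X closure_of D \<subseteq> C" using D(1) C by (intro closure_of_minimal) auto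
  then have FC: "F \<subseteq> C" using F(2) by blast
  have "compactin X F" using comp[OF F(1) FC F(3)] .
  moreover have "F \<subseteq> \<Union>\<J>" using FC cov by (rule order_trans)
  ultimately obtain \<H> where \<H>: "finite \<H>" "\<H> \<subseteq> \<J>" "F \<subseteq> \<Union>\<H>"
    using op by (metis compactinD)
  have "openin X (\<Union>\<H>)" using \<H>(2) op by blast
  then have fin: "finite (D - \<Union>\<H>)" using F(4) \<H>(3) by blast
  define \<G> where "\<G> = \<H> \<union> \<alpha> ` (D - \<Union>\<H>)"
  have "finite \<G>" "\<G> \<subseteq> \<J>" using \<H> fin \<alpha> D(1) by (auto simp: \<G>_def)
  moreover have "C \<inter> Y \<subseteq> \<Union>{U \<in> \<J>. \<exists>G\<in>\<G>. (U, G) \<in> r}"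
  proof
    fix y assume "y \<in> C \<inter> Y"
    then obtain d where d: "d \<in> D" "y \<in> \<alpha> d" using D(3) by blast
    then have dC: "d \<in> C" using D(1) by blast
    have "\<exists>G\<in>\<G>. (\<alpha> d, G) \<in> r"
    proof (cases "d \<in> \<Union>\<H>")
      case True
      then obtain H where "H \<in> \<H>" "d \<in> H" by blast
      then show ?thesis using least[OF dC] \<H>(2) by (auto simp: \<G>_def)
    next
      case False
      then have "\<alpha> d \<in> \<G>" using d by (auto simp: \<G>_def)
      then show ?thesis using refl by blast
    qed
    then show "y \<in> \<Union>{U \<in> \<J>. \<exists>G\<in>\<G>. (U, G) \<in> r}" using \<alpha>[OF dC] d by blast
  qed
  ultimately show ?thesis by blast
qed

text \<open>
  The hypothesis on \<open>F\<close> is the induction hypothesis on the number of pieces: a closed set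
  disjoint from \<open>Y\<close> inside \<open>C\<close> needs only the pieces other than \<open>Y\<close>.
\<close>

lemma closed_subset_initial_segment:
  assumes cc: "countably_compact_space X" and wo: "well_order r"
    and fin: "finite \<Y>"
    and DY: "\<And>Y. Y \<in> \<Y> \<Longrightarrow> D_space (subtopology X Y) \<and> Y \<subseteq> topspace X"
    and C: "closedin X C" "C \<subseteq> \<Union>\<Y>"
    and op: "\<And>U. U \<in> \<J> \<Longrightarrow> openin X U" and cov: "C \<subseteq> \<Union>\<J>" and ne: "\<J> \<noteq> {}"
    and comp: "\<And>F Y. closedin X F \<Longrightarrow> Y \<in> \<Y> \<Longrightarrow> F \<subseteq> \<Union>(\<Y> - {Y}) \<Longrightarrow> compactin X F"
  shows "\<exists>\<delta>\<in>\<J>. C \<subseteq> \<Union>{U \<in> \<J>. (U, \<delta>) \<in> r}"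
proof -
  have lin: "linear_order r" and tr: "trans r"
    using wo by (simp_all add: well_order_on_def linear_order_trans)
  have "\<forall>Y\<in>\<Y>. \<exists>\<G>. finite \<G> \<and> \<G> \<subseteq> \<J> \<and> C \<inter> Y \<subseteq> \<Union>{U \<in> \<J>. \<exists>G\<in>\<G>. (U, G) \<in> r}"
  proof (rule ballI, rule D_piece_initial_segment[OF cc wo _ _ C(1) op cov])
    fix Y assume Y: "Y \<in> \<Y>"
    show "D_space (subtopology X Y)" "Y \<subseteq> topspace X" using DY[OF Y] by simp_all
    fix F assume F: "closedin X F" "F \<subseteq> C" "F \<inter> Y = {}"
    then have "F \<subseteq> \<Union>(\<Y> - {Y})" using C(2) by blast
    then show "compactin X F" using comp[OF F(1) Y] by blast
  qed
  from bchoice[OF this] obtain \<G> where "\<forall>Y\<in>\<Y>. finite (\<G> Y) \<and> \<G> Y \<subseteq> \<J> \<and>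
      C \<inter> Y \<subseteq> \<Union>{U \<in> \<J>. \<exists>G\<in>\<G> Y. (U, G) \<in> r}" ..
  then have \<G>: "finite (\<G> Y)" "\<G> Y \<subseteq> \<J>"
      "C \<inter> Y \<subseteq> \<Union>{U \<in> \<J>. \<exists>G\<in>\<G> Y. (U, G) \<in> r}" if "Y \<in> \<Y>" for Y
    using that by simp_all
  obtain U0 where U0: "U0 \<in> \<J>" using ne by blast
  \<comment> \<open>Adding an arbitrary \<open>U0\<close> guarantees that there is a maximum.\<close>
  define \<H> where "\<H> = insert U0 (\<Union>Y\<in>\<Y>. \<G> Y)"
  have "finite \<H>" "\<H> \<noteq> {}" "\<H> \<subseteq> \<J>"
    using fin \<G>(1,2) U0 unfolding \<H>_def by blast+
  then obtain \<delta> where \<delta>: "\<delta> \<in> \<J>" "\<And>G. G \<in> \<H> \<Longrightarrow> (G, \<delta>) \<in> r"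
    using linear_order_finite_greatest[OF lin, of \<H>] by blast
  have "C \<subseteq> \<Union>{U \<in> \<J>. (U, \<delta>) \<in> r}"
  proof
    fix x assume x: "x \<in> C"
    then obtain Y where Y: "Y \<in> \<Y>" "x \<in> Y" using C(2) by blast
    then obtain U G where U: "U \<in> \<J>" "x \<in> U" "G \<in> \<G> Y" "(U, G) \<in> r"
      using \<G>(3)[OF Y(1)] x by blast
    have "G \<in> \<H>" using U(3) Y(1) unfolding \<H>_def by blast
    then have "(U, \<delta>) \<in> r" using transD[OF tr U(4) \<delta>(2)] by simp
    then show "x \<in> \<Union>{U \<in> \<J>. (U, \<delta>) \<in> r}" using U by blast
  qed
  then show ?thesis using \<delta>(1) by blast
qed

text \<open>
  A cover by the members up to \<open>\<delta>\<close> may well be infinite. Splitting off \<open>\<delta>\<close> itself leaves a closed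
  set covered by strictly earlier members, to which the bound applies again; this handles limit
  and successor positions of \<open>\<delta>\<close> alike.
\<close>

lemma closed_subset_of_finite_D_union_compact:
  assumes cc: "countably_compact_space X" and "finite \<Y>"
    and "\<And>Y. Y \<in> \<Y> \<Longrightarrow> D_space (subtopology X Y) \<and> Y \<subseteq> topspace X"
    and "closedin X C" "C \<subseteq> \<Union>\<Y>"
  shows "compactin X C"
  using assms(2-)
proof (induction \<Y> arbitrary: C rule: finite_psubset_induct)
  case (psubset \<Y>)
  have comp: "compactin X F" if "closedin X F" "Y \<in> \<Y>" "F \<subseteq> \<Union>(\<Y> - {Y})" for F Y
  proof (rule psubset.IH)
    show "\<Y> - {Y} \<subset> \<Y>" using that by blast
  qed (use that psubset.prems(1) in auto)
  obtain r :: "('a set) rel" where wo: "well_order r" using well_order_on by blast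
  then have wf: "wf (r - Id)" by (simp add: well_order_on_def)
  have segment: "\<exists>\<delta>\<in>\<J>. B \<subseteq> \<Union>{U \<in> \<J>. (U, \<delta>) \<in> r}"
    if "closedin X B" "B \<subseteq> \<Union>\<Y>" "\<forall>U\<in>\<J>. openin X U" "B \<subseteq> \<Union>\<J>" "\<J> \<noteq> {}" for B \<J>
    by (rule closed_subset_initial_segment[OF cc wo psubset.hyps])
       (fact psubset.prems(1) that(1,2,4,5) comp bspec[OF that(3)])+
  show ?case
    unfolding compactin_def
  proof (intro conjI allI impI)
    show "C \<subseteq> topspace X" using psubset.prems(2) closedin_subset by blast
    fix \<J> assume \<J>: "(\<forall>U\<in>\<J>. openin X U) \<and> C \<subseteq> \<Union>\<J>"
    have descent: "\<exists>\<F>. finite \<F> \<and> \<F> \<subseteq> \<J> \<and> B \<subseteq> \<Union>\<F>"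
      if "\<delta> \<in> \<J>" "closedin X B" "B \<subseteq> \<Union>\<Y>" "B \<subseteq> \<Union>{U \<in> \<J>. (U, \<delta>) \<in> r}" for \<delta> B
      using that
    proof (induction \<delta> arbitrary: B rule: wf_induct_rule[OF wf])
      case (1 \<delta>)
      let ?B = "B - \<delta>" and ?K = "{U \<in> \<J>. (U, \<delta>) \<in> r - Id}"
      have cl: "closedin X ?B" using 1(2,3) \<J> by (intro closedin_diff) auto
      have cov: "?B \<subseteq> \<Union>?K" using 1(5) by blast
      show ?case
      proof (cases "?K = {}")
        case True
        have "B \<subseteq> \<Union>{\<delta>}" using cov unfolding True by simp
        then show ?thesis using 1(2) by (intro exI[of _ "{\<delta>}"]) simp
      next
        case False
        have BY: "?B \<subseteq> \<Union>\<Y>" using 1(4) by blast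
        have "\<exists>\<delta>'\<in>?K. ?B \<subseteq> \<Union>{U \<in> ?K. (U, \<delta>') \<in> r}"
          by (rule segment[OF cl BY _ cov False]) (use \<J> in simp)
        then obtain \<delta>' where \<delta>': "\<delta>' \<in> ?K" "?B \<subseteq> \<Union>{U \<in> ?K. (U, \<delta>') \<in> r}" ..
        have "\<delta>' \<in> \<J>" "(\<delta>', \<delta>) \<in> r - Id" using \<delta>'(1) by blast+
        moreover have "?B \<subseteq> \<Union>{U \<in> \<J>. (U, \<delta>') \<in> r}" using \<delta>'(2) by blast
        ultimately have "\<exists>\<F>. finite \<F> \<and> \<F> \<subseteq> \<J> \<and> ?B \<subseteq> \<Union>\<F>"
          using 1(1) cl BY by simp
        then obtain \<F> where "finite \<F>" "\<F> \<subseteq> \<J>" "?B \<subseteq> \<Union>\<F>" by blast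
        then show ?thesis using 1(2) by (intro exI[of _ "insert \<delta> \<F>"]) auto
      qed
    qed
    show "\<exists>\<F>. finite \<F> \<and> \<F> \<subseteq> \<J> \<and> C \<subseteq> \<Union>\<F>"
    proof (cases "\<J> = {}")
      case True
      then show ?thesis using \<J> by blast
    next
      case False
      have "\<exists>\<delta>\<in>\<J>. C \<subseteq> \<Union>{U \<in> \<J>. (U, \<delta>) \<in> r}"
        by (rule segment[OF psubset.prems(2,3) _ _ False]) (use \<J> in simp_all)
      then obtain \<delta> where "\<delta> \<in> \<J>" "C \<subseteq> \<Union>{U \<in> \<J>. (U, \<delta>) \<in> r}" ..
      then show ?thesis using descent psubset.prems(2,3) by simp
    qed
  qed
qed

theorem corollary4p3:
  fixes X :: "'a topology" and \<Y> :: "'a set set"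
  assumes "countably_compact_space X"
    and "finite \<Y>"
    and "topspace X = \<Union>\<Y>"
    and "\<And>Y. Y \<in> \<Y> \<Longrightarrow> D_space (subtopology X Y)"
  shows "compact_space X"
  unfolding compact_space_def
proof (rule closed_subset_of_finite_D_union_compact[OF assms(1,2)])
  show "topspace X \<subseteq> \<Union>\<Y>" using assms(3) by simp
  show "D_space (subtopology X Y) \<and> Y \<subseteq> topspace X" if "Y \<in> \<Y>" for Y
    using assms(3,4) that by blast
qed (rule closedin_topspace)

end
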